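(* Let $X$ be a Hausdorff space. (a) $X$ is homeomorphic to the ray space $\mathcal{R}(T)$ of a tree $T$ if and only if $X$ admits a nested clopen subbase that is noetherian and hereditarily complete. (b) $X$ is homeomorphic to the ray space $\mathcal{R}(T)$ of a special tree $T$ if and only if $X$ admits a nested clopen subbase that is noetherian, hereditarily complete and $\sigma$-disjoint.
   Context: Trees: A tree is a partially ordered set $T$ with a unique minimal element such that the set of predecessors of any element is well-ordered. It is special if it is a union of countably many antichains. Distinct limit nodes may have the same set of strict predecessors. A path in $T$ is a nonempty down-closed chain. A ray of $T$ is a path without maximal element. The ray space $\mathcal{R}(T)$ is the set of all rays of $T$ with the subspace topology inherited from $2^T$ (product topology) when rays are identified with their characteristic functions; that is, the topology generated by declaring all sets $[t]=\{x\in\mathcal{R}(T): t\in x\}$, $t\in T$, to be clopen. Subbases: A collection $\mathcal{A}$ of subsets of a topological space $(X,\tau)$ is - a clopen subbase for $X$ if $\tau$ is the smallest topology on $X$ containing all elements of $\mathcal{A}$ as clopen subsets (equivalently, $\mathcal{A}\cup\{X\setminus A: A\in\mathcal{A}\}$ is an open subbase); - nested if for all $A,B\in\mathcal{A}$ with $A\cap B\neq\emptyset$ we have $A\subseteq B$ or $B\subseteq A$; - noetherian if every $\subseteq$-increasing sequence of elements of $\mathcal{A}$ is eventually constant; - centered if every nonempty finite subfamily of $\mathcal{A}$ has nonempty intersection; - complete if every nonempty centered subfamily of $\mathcal{A}$ has nonempty intersection; - hereditarily complete if for every closed subspace $Y\subseteq X$ the collection $\{A\cap Y: A\in\mathcal{A}\}$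 is complete; - $\sigma$-disjoint if $\mathcal{A}$ is a countable union of subcollections each consisting of pairwise disjoint sets. *)

theory Defs
  imports "HOL-Analysis.Analysis"
begin

section \<open>Trees and their ray spaces\<close>

text \<open>
  A tree is given by its set of nodes \<open>T\<close> and its reflexive order \<open>r\<close>, where \<open>(s, t) \<in> r\<close>
  stands for \<open>s \<le> t\<close>; \<open>underS r t\<close> is the set of strict predecessors of \<open>t\<close>.
\<close>

definition tree :: "'b set \<Rightarrow> 'b rel \<Rightarrow> bool" where
  "tree T r \<longleftrightarrow>
     partial_order_on T r \<and>
     (\<exists>!m. m \<in> T \<and> (\<forall>s\<in>T. (s, m) \<in> r \<longrightarrow> s = m)) \<and>
     (\<forall>t\<in>T. well_order_on (underS r t) (Restr r (underS r t)))"

definition tree_antichain :: "'b set \<Rightarrow> 'b rel \<Rightarrow> 'b set \<Rightarrow> bool" where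
  "tree_antichain T r C \<longleftrightarrow> C \<subseteq> T \<and> (\<forall>s\<in>C. \<forall>t\<in>C. (s, t) \<in> r \<longrightarrow> s = t)"

definition special_tree :: "'b set \<Rightarrow> 'b rel \<Rightarrow> bool" where
  "special_tree T r \<longleftrightarrow>
     tree T r \<and> (\<exists>\<C>. countable \<C> \<and> (\<forall>C\<in>\<C>. tree_antichain T r C) \<and> T = \<Union>\<C>)"

definition tree_path :: "'b set \<Rightarrow> 'b rel \<Rightarrow> 'b set \<Rightarrow> bool" where
  "tree_path T r P \<longleftrightarrow>
     P \<noteq> {} \<and> P \<subseteq> T \<and> P \<in> Chains r \<and> (\<forall>t\<in>P. \<forall>s\<in>T. (s, t) \<in> r \<longrightarrow> s \<in> P)"

definition rays :: "'b set \<Rightarrow> 'b rel \<Rightarrow> 'b set set" where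
  "rays T r = {P. tree_path T r P \<and> \<not> (\<exists>m\<in>P. \<forall>s\<in>P. (m, s) \<in> r \<longrightarrow> s = m)}"

text \<open>
  The points are the rays themselves; the pullback along \<open>x \<mapsto> \<chi>\<^sub>x\<close> is the subspace topology
  inherited from \<open>2\<^sup>T\<close>.
\<close>

definition ray_space :: "'b set \<Rightarrow> 'b rel \<Rightarrow> 'b set topology" where
  "ray_space T r =
     pullback_topology (rays T r) (\<lambda>x. \<lambda>t\<in>T. t \<in> x)
       (product_topology (\<lambda>t. discrete_topology (UNIV :: bool set)) T)"


section \<open>Families of subsets of a topological space\<close>

definition clopen_subbase :: "'a topology \<Rightarrow> 'a set set \<Rightarrow> bool" where
  "clopen_subbase X \<A> \<longleftrightarrow>
     (\<forall>A\<in>\<A>. openin X A \<and> closedin X A) \<and>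
     (\<forall>Y. topspace Y = topspace X \<and> (\<forall>A\<in>\<A>. openin Y A \<and> closedin Y A) \<longrightarrow>
          (\<forall>U. openin X U \<longrightarrow> openin Y U))"

definition nested_family :: "'a set set \<Rightarrow> bool" where
  "nested_family \<A> \<longleftrightarrow> (\<forall>A\<in>\<A>. \<forall>B\<in>\<A>. A \<inter> B \<noteq> {} \<longrightarrow> A \<subseteq> B \<or> B \<subseteq> A)"

definition noetherian_family :: "'a set set \<Rightarrow> bool" where
  "noetherian_family \<A> \<longleftrightarrow>
     (\<forall>f :: nat \<Rightarrow> 'a set. range f \<subseteq> \<A> \<and> incseq f \<longrightarrow> (\<exists>N. \<forall>n\<ge>N. f n = f N))"

definition centered_family :: "'a set set \<Rightarrow> bool" where
  "centered_family \<A> \<longleftrightarrow> (\<forall>\<F>. \<F> \<subseteq> \<A> \<and> finite \<F> \<and> \<F> \<noteq> {} \<longrightarrow> \<Inter>\<F> \<noteq> {})"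

definition complete_family :: "'a set set \<Rightarrow> bool" where
  "complete_family \<A> \<longleftrightarrow>
     (\<forall>\<B>. \<B> \<subseteq> \<A> \<and> \<B> \<noteq> {} \<and> centered_family \<B> \<longrightarrow> \<Inter>\<B> \<noteq> {})"

definition hereditarily_complete :: "'a topology \<Rightarrow> 'a set set \<Rightarrow> bool" where
  "hereditarily_complete X \<A> \<longleftrightarrow>
     (\<forall>Y. closedin X Y \<longrightarrow> complete_family ((\<lambda>A. A \<inter> Y) ` \<A>))"

definition sigma_disjoint :: "'a set set \<Rightarrow> bool" where
  "sigma_disjoint \<A> \<longleftrightarrow>
     (\<exists>\<DD>. countable \<DD> \<and> \<A> = \<Union>\<DD> \<and> (\<forall>\<D>\<in>\<DD>. pairwise disjnt \<D>))"


section \<open>Agreement with the alternative descriptions\<close>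

text \<open>
  The whole space is inserted because \<^const>\<open>generate_topology_on\<close> has no empty intersections.
\<close>

lemma clopen_subbase_iff_generated:
  "clopen_subbase X \<A> \<longleftrightarrow>
     \<A> \<subseteq> Pow (topspace X) \<and>
     X = topology_generated_by (insert (topspace X) (\<A> \<union> (\<lambda>A. topspace X - A) ` \<A>))"
    (is "?L \<longleftrightarrow> ?P \<and> X = ?G")
proof
  assume L: ?L
  then have clop: "\<And>A. A \<in> \<A> \<Longrightarrow> openin X A \<and> closedin X A"
    unfolding clopen_subbase_def by blast
  then have P: ?P
    by (auto dest: openin_subset)
  then have top: "topspace ?G = topspace X"
    by auto
  have "openin ?G A \<and> closedin ?G A" if "A \<in> \<A>" for A
  proof
    show "openin ?G A"
      using that by (intro topology_generated_by_Basis) auto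
    have "openin ?G (topspace X - A)"
      using that by (intro topology_generated_by_Basis) auto
    then show "closedin ?G A"
      using that P unfolding closedin_def top by auto
  qed
  with L top have "openin ?G U" if "openin X U" for U
    using that unfolding clopen_subbase_def by blast
  moreover have "openin X U" if "openin ?G U" for U
  proof (rule generate_topology_on_coarsest[OF istopology_openin _ openin_topology_generated_by[OF that]])
    fix S assume "S \<in> insert (topspace X) (\<A> \<union> (\<lambda>A. topspace X - A) ` \<A>)"
    then show "openin X S"
      using clop by auto
  qed
  ultimately show "?P \<and> X = ?G"
    using P unfolding topology_eq by blast
next
  assume R: "?P \<and> X = ?G"
  then have gen: "openin X U \<longleftrightarrow>
      generate_topology_on (insert (topspace X) (\<A> \<union> (\<lambda>A. topspace X - A) ` \<A>)) U" for U
    by (metis openin_topology_generated_by_iff)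
  have "openin X A \<and> closedin X A" if "A \<in> \<A>" for A
  proof -
    have "openin X A" "openin X (topspace X - A)"
      unfolding gen using that by (auto intro!: generate_topology_on.Basis)
    then show ?thesis
      using openin_subset by (auto simp: closedin_def)
  qed
  moreover have "openin Y U"
    if Y: "topspace Y = topspace X" "\<forall>A\<in>\<A>. openin Y A \<and> closedin Y A" and U: "openin X U" for Y U
  proof (rule generate_topology_on_coarsest[OF istopology_openin _ U[unfolded gen]])
    fix S assume "S \<in> insert (topspace X) (\<A> \<union> (\<lambda>A. topspace X - A) ` \<A>)"
    then show "openin Y S"
      using Y by (metis (no_types, lifting) Un_iff closedin_def imageE insert_iff openin_topspace)
  qed
  ultimately show ?L
    unfolding clopen_subbase_def by blast
qed

lemma topspace_ray_space [simp]: "topspace (ray_space T r) = rays T r"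
  by (auto simp: ray_space_def topspace_pullback_topology)

lemma ray_space_clopen_subbase:
  "clopen_subbase (ray_space T r) ((\<lambda>t. {x \<in> rays T r. t \<in> x}) ` T)"
proof -
  let ?D = "\<lambda>t. discrete_topology (UNIV :: bool set)"
  let ?\<chi> = "\<lambda>x. \<lambda>t\<in>T. t \<in> x"
  let ?R = "rays T r"
  have proj: "openin (ray_space T r) {x \<in> ?R. (t \<in> x) = b}" if t: "t \<in> T" for t b
  proof -
    have "continuous_map (product_topology ?D T) (?D t) (\<lambda>f. f t)"
      using t by (rule continuous_map_product_projection)
    then have "openin (product_topology ?D T)
        {f \<in> topspace (product_topology ?D T). f t \<in> {b}}"
      by (rule openin_continuous_map_preimage) simp
    moreover have "{x \<in> ?R. (t \<in> x) = b} =
        ?\<chi> -` {f \<in> topspace (product_topology ?D T). f t \<in> {b}} \<inter> ?R"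
      using t by auto
    ultimately show ?thesis
      unfolding ray_space_def openin_pullback_topology by blast
  qed
  have clopen: "openin (ray_space T r) {x \<in> ?R. t \<in> x} \<and> closedin (ray_space T r) {x \<in> ?R. t \<in> x}"
    if "t \<in> T" for t
  proof -
    have "?R - {x \<in> ?R. t \<in> x} = {x \<in> ?R. (t \<in> x) = False}"
      by auto
    then show ?thesis
      using proj[OF that, of True] proj[OF that, of False] by (auto simp: closedin_def)
  qed
  have smallest: "openin Y U"
    if Y: "topspace Y = ?R"
      and clop: "\<And>t. t \<in> T \<Longrightarrow> openin Y {x \<in> ?R. t \<in> x} \<and> closedin Y {x \<in> ?R. t \<in> x}"
      and U: "openin (ray_space T r) U" for Y U
  proof -
    obtain V where V: "openin (product_topology ?D T) V" "U = ?\<chi> -` V \<inter> ?R"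
      using U unfolding ray_space_def openin_pullback_topology by blast
    have "continuous_map Y (?D t) (\<lambda>x. ?\<chi> x t)" if t: "t \<in> T" for t
    proof -
      have "openin Y {x \<in> topspace Y. ?\<chi> x t \<in> W}" for W
      proof -
        have pos: "openin Y {x \<in> ?R. t \<in> x}"
          using clop[OF t] by blast
        have "openin Y (?R - {x \<in> ?R. t \<in> x})"
          using clop[OF t] Y by (simp add: closedin_def)
        moreover have "?R - {x \<in> ?R. t \<in> x} = {x \<in> ?R. t \<notin> x}"
          by auto
        ultimately have neg: "openin Y {x \<in> ?R. t \<notin> x}"
          by simp
        have "{x \<in> topspace Y. ?\<chi> x t \<in> W} =
            (if True \<in> W then {x \<in> ?R. t \<in> x} else {}) \<union>
            (if False \<in> W then {x \<in> ?R. t \<notin> x} else {})" (is "?A = ?B")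
        proof (rule set_eqI)
          show "x \<in> ?A \<longleftrightarrow> x \<in> ?B" for x
            using t Y by (cases "t \<in> x") auto
        qed
        then show ?thesis
          using pos neg by (auto intro: openin_Un)
      qed
      then show ?thesis
        unfolding continuous_map_def by simp
    qed
    then have "continuous_map Y (product_topology ?D T) ?\<chi>"
      by (auto simp: continuous_map_componentwise)
    then have "openin Y {x \<in> topspace Y. ?\<chi> x \<in> V}"
      using V(1) by (rule openin_continuous_map_preimage)
    moreover have "{x \<in> topspace Y. ?\<chi> x \<in> V} = U"
      using V(2) Y by auto
    ultimately show ?thesis
      by simp
  qed
  show ?thesis
    unfolding clopen_subbase_def topspace_ray_space ball_simps
    using clopen smallest by blast
qed

end

theory Submission
  imports Defs
begin

text \<open>
  The cones \<open>[t]\<close> of a tree form the required subbase. Conversely, let \<open>\<B>\<close> be the nonempty members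
  of the subbase together with the whole space, ordered by reverse inclusion. Each point \<open>x\<close> gives
  the path \<open>{A \<in> \<B>. x \<in> A}\<close>, and by hereditary completeness every path without a last element
  arises in this way: otherwise its intersection would be a union of members of \<open>\<B>\<close>, hence open,
  and completeness would fail on the complement. A path with last element \<open>A\<close> arises from a point
  iff \<open>A\<close> is not covered by its proper subsets in \<open>\<B>\<close>. So replacing each uncovered \<open>A\<close> by a copy of
  \<open>\<omega>\<close> turns precisely the paths arising from points into rays.
\<close>

section \<open>Clopen subbases\<close>

lemma clopen_subbase_clopen:
  assumes "clopen_subbase X \<A>" and "A \<in> \<A>"
  shows "openin X A \<and> closedin X A"
  using bspec[OF conjunct1[OF assms(1)[unfolded clopen_subbase_def]] assms(2)] .

lemma clopen_subbase_generates:
  assumes "clopen_subbase X \<A>" and "openin X U"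
  shows "generate_topology_on (insert (topspace X) (\<A> \<union> (\<lambda>A. topspace X - A) ` \<A>)) U"
proof -
  have "X = topology_generated_by (insert (topspace X) (\<A> \<union> (\<lambda>A. topspace X - A) ` \<A>))"
    using assms(1) unfolding clopen_subbase_iff_generated by (rule conjunct2)
  from arg_cong[OF this, of "\<lambda>X. openin X U"] show ?thesis
    using assms(2) by (simp add: openin_topology_generated_by_iff)
qed

text \<open>Preimages commute with complements, so a clopen preimage settles both a member and its
  complement, and these generate the topology of \<open>Z\<close>.\<close>

lemma continuous_map_clopen_subbase:
  assumes "clopen_subbase Z \<B>" and "f \<in> topspace Y \<rightarrow> topspace Z"
    and "\<And>B. B \<in> \<B> \<Longrightarrow> openin Y {x \<in> topspace Y. f x \<in> B} \<and> closedin Y {x \<in> topspace Y. f x \<in> B}"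
  shows "continuous_map Y Z f"
proof -
  let ?S = "insert (topspace Z) (\<B> \<union> (\<lambda>A. topspace Z - A) ` \<B>)"
  have "continuous_map Y (topology_generated_by ?S) f"
  proof (rule continuous_on_generated_topo)
    fix U assume "U \<in> ?S"
    then consider "U = topspace Z" | "U \<in> \<B>" | B where "B \<in> \<B>" "U = topspace Z - B"
      by blast
    then show "openin Y (f -` U \<inter> topspace Y)"
    proof cases
      case 1
      then have "f -` U \<inter> topspace Y = topspace Y"
        using assms(2) by auto
      then show ?thesis
        by simp
    next
      case 2
      have "f -` U \<inter> topspace Y = {x \<in> topspace Y. f x \<in> U}"
        by auto
      then show ?thesis
        using assms(3)[OF 2] by simp
    next
      case 3
      have "f -` U \<inter> topspace Y = topspace Y - {x \<in> topspace Y. f x \<in> B}"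
        using assms(2) 3 by auto
      then show ?thesis
        using assms(3)[OF 3(1)] by (simp add: closedin_def)
    qed
  qed (use assms(2) in auto)
  then show ?thesis
    using assms(1) unfolding clopen_subbase_iff_generated by metis
qed

text \<open>Carries the cones of a ray space over to a homeomorphic space. For minimality, a
  topology \<open>Y\<close> that makes the pulled-back sets clopen makes \<open>h\<close> continuous
  into \<open>Z\<close>, and an open \<open>U\<close> is the preimage of its image, which is open in
  \<open>Z\<close>.\<close>

lemma clopen_subbase_pullback:
  assumes Z: "clopen_subbase Z \<B>" and h: "homeomorphic_map X Z h"
  shows "clopen_subbase X ((\<lambda>B. {x \<in> topspace X. h x \<in> B}) ` \<B>)"
proof -
  have cont: "continuous_map X Z h" and im: "h ` topspace X = topspace Z"
    and inj: "inj_on h (topspace X)"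
    using h by (simp_all add: homeomorphic_eq_everything_map)
  have "openin X {x \<in> topspace X. h x \<in> B} \<and> closedin X {x \<in> topspace X. h x \<in> B}"
    if "B \<in> \<B>" for B
    using clopen_subbase_clopen[OF Z that] cont
    by (blast intro: openin_continuous_map_preimage closedin_continuous_map_preimage)
  moreover have "openin Y U"
    if Y: "topspace Y = topspace X"
      and clop: "\<forall>B\<in>\<B>. openin Y {x \<in> topspace X. h x \<in> B} \<and> closedin Y {x \<in> topspace X. h x \<in> B}"
      and U: "openin X U" for Y U
  proof -
    have "continuous_map Y Z h"
      using Z by (rule continuous_map_clopen_subbase) (use Y clop im in auto)
    moreover have "openin Z (h ` U)"
      using homeomorphic_map_openness_eq[OF h] U by blast
    ultimately have "openin Y {x \<in> topspace Y. h x \<in> h ` U}"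
      by (rule openin_continuous_map_preimage)
    moreover have "{x \<in> topspace Y. h x \<in> h ` U} = U"
      using inj openin_subset[OF U] unfolding Y inj_on_def by blast
    ultimately show ?thesis
      by simp
  qed
  ultimately show ?thesis
    unfolding clopen_subbase_def ball_simps by blast
qed

text \<open>By induction on generation, points that lie in the same members of \<open>\<A>\<close>
  lie in the same open sets.\<close>

lemma clopen_subbase_separates:
  assumes "clopen_subbase X \<A>" and "openin X U" and "x \<in> U" and "y \<in> topspace X" and "y \<notin> U"
  obtains A where "A \<in> \<A>" and "(x \<in> A) \<noteq> (y \<in> A)"
proof (rule ccontr)
  assume "\<not> thesis"
  then have same: "\<forall>A\<in>\<A>. x \<in> A \<longleftrightarrow> y \<in> A"
    using that by blast
  have x: "x \<in> topspace X"
    using assms(2,3) openin_subset by blast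
  have "generate_topology_on (insert (topspace X) (\<A> \<union> (\<lambda>A. topspace X - A) ` \<A>)) U"
    using assms(1,2) by (rule clopen_subbase_generates)
  then have "x \<in> U \<longleftrightarrow> y \<in> U"
    by induction (use same x assms(4) in auto)
  then show False
    using assms(3,5) by simp
qed

section \<open>The subbase of cones\<close>

lemma special_tree_imp_tree: "special_tree T r \<Longrightarrow> tree T r"
  by (simp add: special_tree_def)

text \<open>Only sets of strict predecessors are known to be well-ordered, so an element
  \<open>a\<close> of \<open>C\<close> is fixed first. Either \<open>a\<close> is least, or the
  least element of \<open>C\<close> strictly below \<open>a\<close> is also below everything in
  \<open>C\<close> above \<open>a\<close>.\<close>

lemma tree_chain_least:
  assumes "tree T r" and "C \<subseteq> T" and "C \<in> Chains r" and "C \<noteq> {}"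
  obtains m where "m \<in> C" and "\<And>c. c \<in> C \<Longrightarrow> (m, c) \<in> r"
proof -
  obtain a where a: "a \<in> C"
    using assms(4) by blast
  have comp: "(s, t) \<in> r \<or> (t, s) \<in> r" if "s \<in> C" "t \<in> C" for s t
    using assms(3) that by (auto simp: Chains_def)
  have tr: "trans r" and refl: "refl_on T r"
    using assms(1) by (auto simp: tree_def order_on_defs)
  show thesis
  proof (cases "C \<inter> underS r a = {}")
    case True
    then have "(a, c) \<in> r" if "c \<in> C" for c
      using comp[OF a that] that comp[OF a a] by (auto simp: underS_def)
    then show thesis
      using that a by blast
  next
    case False
    have "wf (Restr r (underS r a) - Id)"
      using assms(1,2) a by (auto simp: tree_def well_order_on_def)
    then obtain m where m: "m \<in> C \<inter> underS r a"
      and min: "\<And>y. (y, m) \<in> Restr r (underS r a) - Id \<Longrightarrow> y \<notin> C \<inter> underS r a"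
      using wfE_min' False by metis
    have "(m, c) \<in> r" if c: "c \<in> C" for c
    proof (cases "c \<in> underS r a")
      case True
      then show ?thesis
        using min[of c] comp[of m c] m c by auto
    next
      case False
      then have "(a, c) \<in> r"
        using comp[OF a c] comp[OF a a] by (auto simp: underS_def)
      then show ?thesis
        using m tr by (auto simp: underS_def dest: transD)
    qed
    then show thesis
      using that m by blast
  qed
qed

lemma tree_predecessors_comparable:
  assumes "tree T r" and "(s, u) \<in> r" and "(t, u) \<in> r"
  shows "(s, t) \<in> r \<or> (t, s) \<in> r"
proof (cases "s = u \<or> t = u \<or> s = t")
  case True
  then show ?thesis
    using assms by (auto simp: tree_def order_on_defs refl_on_def)
next
  case False
  have "u \<in> T"
    using assms by (auto simp: tree_def order_on_defs)
  then have "total_on (underS r u) (Restr r (underS r u))"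
    using assms(1) by (auto simp: tree_def order_on_defs)
  then show ?thesis
    using False assms(2,3) by (auto simp: total_on_def underS_def)
qed

lemma rays_tree_path: "x \<in> rays T r \<Longrightarrow> tree_path T r x"
  unfolding rays_def mem_Collect_eq by (rule conjunct1)

lemma rays_comparable:
  assumes "x \<in> rays T r" and "s \<in> x" and "t \<in> x"
  shows "(s, t) \<in> r \<or> (t, s) \<in> r"
proof -
  have "x \<in> Chains r"
    using rays_tree_path[OF assms(1)] by (simp add: tree_path_def)
  then show ?thesis
    using assms(2,3) by (simp add: Chains_def)
qed

lemma rays_downward:
  assumes "tree T r" and "x \<in> rays T r" and "t \<in> x" and "(s, t) \<in> r"
  shows "s \<in> x"
proof -
  have "s \<in> T"
    using assms(1,4) by (auto simp: tree_def order_on_defs)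
  then show ?thesis
    using rays_tree_path[OF assms(2)] assms(3,4) by (simp add: tree_path_def)
qed

text \<open>Two nodes of the down-closure lie below two comparable elements of \<open>S\<close>,
  hence below the larger one, and predecessors of one node are comparable. As no element of
  \<open>S\<close> bounds \<open>S\<close>, the closure has no maximal element.\<close>

lemma down_closure_in_rays:
  assumes tree: "tree T r" and S: "S \<subseteq> T" "S \<in> Chains r" "S \<noteq> {}"
    and no_max: "\<And>m. m \<in> S \<Longrightarrow> \<exists>s\<in>S. (s, m) \<notin> r"
  shows "{t. \<exists>s\<in>S. (t, s) \<in> r} \<in> rays T r"
proof -
  let ?D = "{t. \<exists>s\<in>S. (t, s) \<in> r}"
  have tr: "trans r" and refl: "\<And>t. t \<in> T \<Longrightarrow> (t, t) \<in> r" and sub: "r \<subseteq> T \<times> T"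
    using tree by (auto simp: tree_def order_on_defs refl_on_def)
  have "?D \<noteq> {}"
    using S refl by blast
  moreover have "?D \<subseteq> T"
    using sub by blast
  moreover have "?D \<in> Chains r"
  proof -
    have "(t, t') \<in> r \<or> (t', t) \<in> r"
      if t: "s \<in> S" "(t, s) \<in> r" and t': "s' \<in> S" "(t', s') \<in> r" for s s' t t'
    proof -
      have "(s, s') \<in> r \<or> (s', s) \<in> r"
        using S(2) t(1) t'(1) by (auto simp: Chains_def)
      then have "(t, s') \<in> r \<or> (t', s) \<in> r"
        using t t' tr by (blast dest: transD)
      then show ?thesis
        using tree_predecessors_comparable[OF tree] t(2) t'(2) by blast
    qed
    then show ?thesis
      unfolding Chains_def by blast
  qed
  moreover have "\<forall>t\<in>?D. \<forall>s\<in>T. (s, t) \<in> r \<longrightarrow> s \<in> ?D"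
    using tr by (blast dest: transD)
  moreover have "\<exists>s\<in>?D. (m, s) \<in> r \<and> s \<noteq> m" if m: "m \<in> ?D" for m
  proof -
    obtain s where s: "s \<in> S" "(m, s) \<in> r"
      using m by blast
    obtain s' where "s' \<in> S" "(s', s) \<notin> r"
      using no_max s(1) by blast
    then have "(s, s') \<in> r" "s' \<in> S" "s' \<noteq> m"
      using S(2) s by (auto simp: Chains_def)
    moreover have "s' \<in> ?D"
      using S(1) refl \<open>s' \<in> S\<close> by blast
    ultimately show ?thesis
      using s(2) tr by (blast dest: transD)
  qed
  ultimately show ?thesis
    unfolding rays_def tree_path_def by blast
qed

text \<open>Basic neighbourhoods of the down-closure of \<open>S\<close> impose finitely many
  conditions that a node does or does not belong to the ray. On \<open>Y\<close> all of them follow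
  from finitely many memberships of elements of \<open>S\<close>. The set \<open>F\<close> is kept
  nonempty because centeredness only speaks of nonempty subfamilies.\<close>

lemma ray_space_neighbourhood:
  assumes tree: "tree T r" and S: "S \<subseteq> T" "S \<noteq> {}"
    and mem: "{t. \<exists>s\<in>S. (t, s) \<in> r} \<in> U"
    and no_bound: "\<And>y. y \<in> Y \<Longrightarrow> \<exists>s\<in>S. s \<notin> y"
    and Y: "Y \<subseteq> rays T r"
    and U: "openin (ray_space T r) U"
  obtains F where "finite F" and "F \<noteq> {}" and "F \<subseteq> S" and "\<And>y. y \<in> Y \<Longrightarrow> F \<subseteq> y \<Longrightarrow> y \<in> U"
proof -
  define D where "D = {t. \<exists>s\<in>S. (t, s) \<in> r}"
  let ?C = "(\<lambda>t. {x \<in> rays T r. t \<in> x}) ` T"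
  let ?N = "\<lambda>U. \<exists>F. finite F \<and> F \<noteq> {} \<and> F \<subseteq> S \<and> (\<forall>y\<in>Y. F \<subseteq> y \<longrightarrow> y \<in> U)"
  obtain s0 where s0: "s0 \<in> S"
    using S(2) by blast
  have "generate_topology_on (insert (rays T r) (?C \<union> (\<lambda>A. rays T r - A) ` ?C)) U"
    using clopen_subbase_generates[OF ray_space_clopen_subbase U] by simp
  then have "D \<in> U \<longrightarrow> ?N U"
  proof induction
    case Empty
    then show ?case
      by simp
  next
    case (Int a b)
    show ?case
    proof
      assume "D \<in> a \<inter> b"
      then obtain F G where "finite F" "F \<noteq> {}" "F \<subseteq> S" "\<forall>y\<in>Y. F \<subseteq> y \<longrightarrow> y \<in> a"
        and "finite G" "G \<subseteq> S" "\<forall>y\<in>Y. G \<subseteq> y \<longrightarrow> y \<in> b"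
        using Int.IH by blast
      then show "?N (a \<inter> b)"
        by (intro exI[of _ "F \<union> G"]) auto
    qed
  next
    case (UN K)
    show ?case
    proof
      assume "D \<in> \<Union>K"
      then obtain k where k: "k \<in> K" "D \<in> k"
        by (rule UnionE)
      then obtain F where "finite F" "F \<noteq> {}" "F \<subseteq> S" "\<forall>y\<in>Y. F \<subseteq> y \<longrightarrow> y \<in> k"
        using UN.IH[of k] by auto
      then show "?N (\<Union>K)"
        using k by (intro exI[of _ F]) auto
    qed
  next
    case (Basis V)
    then consider "V = rays T r" | t where "t \<in> T" "V = {x \<in> rays T r. t \<in> x}"
      | t where "t \<in> T" "V = rays T r - {x \<in> rays T r. t \<in> x}"
      by auto
    then show ?case
    proof cases
      case 1
      then show ?thesis
        using s0 Y by (intro impI exI[of _ "{s0}"]) auto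
    next
      case 2
      show ?thesis
      proof
        assume "D \<in> V"
        then obtain s where "s \<in> S" "(t, s) \<in> r"
          using 2 by (auto simp: D_def)
        then show "?N V"
          using 2 Y rays_downward[OF tree] by (intro exI[of _ "{s}"]) auto
      qed
    next
      case 3
      show ?thesis
      proof
        assume "D \<in> V"
        then have above: "(t, s) \<notin> r" if "s \<in> S" for s
          using 3 that by (auto simp: D_def)
        \<comment> \<open>This trades the negative condition on \<open>t\<close> for a positive one
          on some \<open>s\<close>. If no \<open>s\<close> worked, each would share a ray with
          \<open>t\<close>, hence lie below \<open>t\<close>, since \<open>t\<close> is below no
          element of \<open>S\<close>. A ray of \<open>Y\<close> through \<open>t\<close> would then
          contain all of \<open>S\<close>.\<close>
        have "\<exists>s\<in>S. \<forall>y\<in>Y. s \<in> y \<longrightarrow> t \<notin> y"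
        proof (rule ccontr)
          assume contra: "\<not> ?thesis"
          have below: "(s, t) \<in> r" if "s \<in> S" for s
          proof -
            from contra that obtain y where "y \<in> Y" "s \<in> y" "t \<in> y"
              by blast
            then show ?thesis
              using rays_comparable[of y T r s t] Y above[OF that] by blast
          qed
          obtain y where "y \<in> Y" "t \<in> y"
            using contra s0 by blast
          then have "\<forall>s\<in>S. s \<in> y"
            using below Y rays_downward[OF tree] by blast
          then show False
            using no_bound \<open>y \<in> Y\<close> by blast
        qed
        then obtain s where "s \<in> S" "\<forall>y\<in>Y. s \<in> y \<longrightarrow> t \<notin> y"
          by blast
        then show "?N V"
          using 3 Y by (intro exI[of _ "{s}"]) auto
      qed
    qed
  qed
  then show thesis
    using mem that unfolding D_def by blast
qed

section \<open>The cones of a tree, pulled back to the space, as a subbase\<close>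

definition cones :: "'b set \<Rightarrow> 'b rel \<Rightarrow> 'a topology \<Rightarrow> ('a \<Rightarrow> 'b set) \<Rightarrow> 'a set set" where
  "cones T r X h = (\<lambda>t. {x \<in> topspace X. t \<in> h x}) ` T"

lemma clopen_subbase_cones:
  assumes "homeomorphic_map X (ray_space T r) h"
  shows "clopen_subbase X (cones T r X h)"
proof -
  have "h ` topspace X = rays T r"
    using homeomorphic_imp_surjective_map[OF assms] by simp
  then have "cones T r X h =
      (\<lambda>B. {x \<in> topspace X. h x \<in> B}) ` (\<lambda>t. {x \<in> rays T r. t \<in> x}) ` T"
    unfolding cones_def image_image by (intro image_cong) auto
  then show ?thesis
    using clopen_subbase_pullback[OF ray_space_clopen_subbase assms] by metis
qed

text \<open>Nodes of intersecting cones lie on a common ray and are comparable, and the larger node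
  has the smaller cone.\<close>

lemma nested_cones:
  assumes "tree T r" and "h ` topspace X \<subseteq> rays T r"
  shows "nested_family (cones T r X h)"
  unfolding nested_family_def cones_def
proof (intro ballI impI; elim imageE)
  fix A B s t assume *: "A = {x \<in> topspace X. s \<in> h x}" "B = {x \<in> topspace X. t \<in> h x}" "A \<inter> B \<noteq> {}"
  then obtain x where x: "x \<in> topspace X" "s \<in> h x" "t \<in> h x"
    by blast
  have ray: "h x \<in> rays T r" if "x \<in> topspace X" for x
    using assms(2) that by blast
  have "(s, t) \<in> r \<or> (t, s) \<in> r"
    using rays_comparable[OF ray] x by blast
  moreover have "{x \<in> topspace X. b \<in> h x} \<subseteq> {x \<in> topspace X. a \<in> h x}" if "(a, b) \<in> r" for a b
    using rays_downward[OF assms(1) ray _ that] by blast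
  ultimately show "A \<subseteq> B \<or> B \<subseteq> A"
    using * by blast
qed

text \<open>Once a point \<open>x\<close> has appeared in the sequence it stays, so from then on all
  nodes lie on the ray of \<open>x\<close>. The least of these nodes has the largest cone, and the
  sequence is constant from there on.\<close>

lemma noetherian_cones:
  fixes X :: "'a topology"
  assumes tree: "tree T r" and h: "h ` topspace X \<subseteq> rays T r"
  shows "noetherian_family (cones T r X h)"
  unfolding noetherian_family_def
proof (intro allI impI; elim conjE)
  fix f :: "nat \<Rightarrow> 'a set" assume f: "range f \<subseteq> cones T r X h" "incseq f"
  show "\<exists>N. \<forall>n\<ge>N. f n = f N"
  proof (cases "\<forall>n. f n = {}")
    case False
    then obtain k x where x: "x \<in> f k"
      by blast
    have "\<forall>n. \<exists>t. t \<in> T \<and> f n = {x \<in> topspace X. t \<in> h x}"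
      using f(1) by (auto simp: cones_def image_subset_iff)
    then obtain t where t: "\<And>n. t n \<in> T" "\<And>n. f n = {x \<in> topspace X. t n \<in> h x}"
      by metis
    have "x \<in> f n" if "n \<ge> k" for n
      using x f(2) that by (auto simp: incseq_def)
    then have tx: "t n \<in> h x" if "n \<ge> k" for n
      using t(2) that by blast
    have xX: "x \<in> topspace X"
      using x t(2) by blast
    then have ray: "h x \<in> rays T r"
      using h by blast
    have "t ` {k..} \<in> Chains r"
      using rays_comparable[OF ray] tx by (auto simp: Chains_def)
    then obtain m where m: "m \<in> t ` {k..}" "\<And>c. c \<in> t ` {k..} \<Longrightarrow> (m, c) \<in> r"
      using tree_chain_least[OF tree, of "t ` {k..}"] t(1) by blast
    then obtain N where N: "N \<ge> k" "m = t N"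
      by auto
    have "f n = f N" if "n \<ge> N" for n
    proof
      have "(t N, t n) \<in> r"
        using m(2)[of "t n"] N that by auto
      then have "t N \<in> h x" if "x \<in> topspace X" "t n \<in> h x" for x
        using rays_downward[OF tree _ that(2)] h that(1) by blast
      then show "f n \<subseteq> f N"
        unfolding t(2) by blast
      show "f N \<subseteq> f n"
        using f(2) that by (auto simp: incseq_def)
    qed
    then show ?thesis
      by blast
  qed auto
qed

text \<open>A centered family of traces comes from a chain \<open>S\<close> of nodes. If no ray of
  \<open>Y\<close> contained \<open>S\<close>, the down-closure of \<open>S\<close> would be a ray
  outside the closed set \<open>Y\<close>, and some finite part of \<open>S\<close> would already
  keep rays of \<open>Y\<close> away, against centeredness.\<close>

lemma hereditarily_complete_cones:
  assumes tree: "tree T r" and h: "homeomorphic_map X (ray_space T r) h"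
  shows "hereditarily_complete X (cones T r X h)"
  unfolding hereditarily_complete_def complete_family_def
proof (intro allI impI; elim conjE)
  fix Y \<B>
  assume Y: "closedin X Y" and \<B>: "\<B> \<subseteq> (\<lambda>A. A \<inter> Y) ` cones T r X h" "\<B> \<noteq> {}" "centered_family \<B>"
  have im: "h ` topspace X = rays T r"
    using homeomorphic_imp_surjective_map[OF h] by simp
  have YX: "Y \<subseteq> topspace X"
    using closedin_subset[OF Y] .
  then have hY: "h ` Y \<subseteq> rays T r"
    using im by blast
  let ?c = "\<lambda>t. {x \<in> topspace X. t \<in> h x} \<inter> Y"
  define S where "S = {t \<in> T. ?c t \<in> \<B>}"
  have \<B>S: "\<B> = ?c ` S"
    using \<B>(1) by (auto simp: S_def cones_def)
  have S: "S \<subseteq> T" "S \<noteq> {}"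
    unfolding S_def using \<B>(1,2) by (auto simp: cones_def)
  have cent: "\<exists>y\<in>Y. F \<subseteq> h y" if "finite F" "F \<noteq> {}" "F \<subseteq> S" for F
  proof -
    have "?c ` F \<subseteq> \<B> \<and> finite (?c ` F) \<and> ?c ` F \<noteq> {}"
      using that unfolding S_def by blast
    then have "\<Inter>(?c ` F) \<noteq> {}"
      by (rule \<B>(3)[unfolded centered_family_def, rule_format])
    then obtain y where "\<forall>t\<in>F. y \<in> ?c t"
      by blast
    then show ?thesis
      using that(2) by blast
  qed
  have chain: "S \<in> Chains r"
    unfolding Chains_def
  proof (intro CollectI ballI)
    fix s t assume "s \<in> S" "t \<in> S"
    then obtain y where y: "y \<in> Y" "s \<in> h y" "t \<in> h y"
      using cent[of "{s, t}"] by auto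
    then have "h y \<in> rays T r"
      using hY by blast
    then show "(s, t) \<in> r \<or> (t, s) \<in> r"
      using rays_comparable y(2,3) by metis
  qed
  have "\<exists>y\<in>Y. S \<subseteq> h y"
  proof (rule ccontr)
    assume contra: "\<not> ?thesis"
    let ?D = "{t. \<exists>s\<in>S. (t, s) \<in> r}"
    \<comment> \<open>If \<open>m\<close> bounded \<open>S\<close>, the ray of any point of
      \<open>Y\<close> in the cone of \<open>m\<close> would contain \<open>S\<close>.\<close>
    have "\<exists>s\<in>S. (s, m) \<notin> r" if m: "m \<in> S" for m
    proof -
      obtain y where y: "y \<in> Y" "m \<in> h y"
        using cent[of "{m}"] m by auto
      then have "h y \<in> rays T r"
        using hY by blast
      moreover obtain s where "s \<in> S" "s \<notin> h y"
        using contra y(1) by blast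
      ultimately show ?thesis
        using y(2) rays_downward[OF tree] by metis
    qed
    then have D: "?D \<in> rays T r"
      using down_closure_in_rays[OF tree S(1) chain S(2)] by blast
    have "S \<subseteq> ?D"
      using S(1) tree by (auto simp: tree_def order_on_defs refl_on_def)
    moreover obtain x where x: "x \<in> topspace X" "h x = ?D"
      using D im by (metis (lifting) imageE)
    ultimately have "x \<notin> Y"
      using contra by metis
    then have mem: "?D \<in> h ` (topspace X - Y)"
      using x by (metis (lifting) DiffI imageI)
    \<comment> \<open>Closedness of \<open>Y\<close> enters here: the complement is an open
      neighbourhood of \<open>?D\<close> in the ray space.\<close>
    have op: "openin (ray_space T r) (h ` (topspace X - Y))"
      using homeomorphic_map_openness_eq[OF h] Y by (simp add: closedin_def)
    have "\<And>y. y \<in> h ` Y \<Longrightarrow> \<exists>s\<in>S. s \<notin> y"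
      using contra by blast
    then obtain F where F: "finite F" "F \<noteq> {}" "F \<subseteq> S"
      "\<And>y. y \<in> h ` Y \<Longrightarrow> F \<subseteq> y \<Longrightarrow> y \<in> h ` (topspace X - Y)"
      using ray_space_neighbourhood[OF tree S mem _ hY op] by blast
    obtain y where "y \<in> Y" "F \<subseteq> h y"
      using cent[OF F(1-3)] by blast
    moreover from this have "h y \<in> h ` (topspace X - Y)"
      using F(4) by blast
    ultimately obtain x where "x \<in> topspace X - Y" "y \<in> Y" "h x = h y"
      by force
    then show False
      using homeomorphic_imp_injective_map[OF h] YX by (auto simp: inj_on_def)
  qed
  then obtain y where "y \<in> Y" "S \<subseteq> h y"
    by blast
  then have "y \<in> \<Inter>\<B>"
    unfolding \<B>S using YX by blast
  then show "\<Inter>\<B> \<noteq> {}"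
    by blast
qed

text \<open>A ray is a chain and meets an antichain at most once, so the nodes of one antichain have
  disjoint cones.\<close>

lemma sigma_disjoint_cones:
  assumes "special_tree T r" and "h ` topspace X \<subseteq> rays T r"
  shows "sigma_disjoint (cones T r X h)"
proof -
  obtain \<C> where \<C>: "countable \<C>" "\<And>C. C \<in> \<C> \<Longrightarrow> tree_antichain T r C" "T = \<Union>\<C>"
    using assms(1) by (auto simp: special_tree_def)
  have "pairwise disjnt ((\<lambda>t. {x \<in> topspace X. t \<in> h x}) ` C)" if "C \<in> \<C>" for C
  proof (rule pairwise_imageI)
    fix s t assume "s \<in> C" "t \<in> C" "s \<noteq> t"
    then have "(s, t) \<notin> r" "(t, s) \<notin> r"
      using \<C>(2)[OF that] by (auto simp: tree_antichain_def)
    then have "\<not> (s \<in> h x \<and> t \<in> h x)" if "x \<in> topspace X" for x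
      using rays_comparable[of "h x" T r s t] assms(2) that by blast
    then show "disjnt {x \<in> topspace X. s \<in> h x} {x \<in> topspace X. t \<in> h x}"
      unfolding disjnt_def by blast
  qed
  moreover have "cones T r X h = \<Union>((\<lambda>C. (\<lambda>t. {x \<in> topspace X. t \<in> h x}) ` C) ` \<C>)"
    unfolding cones_def \<C>(3) by blast
  ultimately show ?thesis
    unfolding sigma_disjoint_def using \<C>(1) by blast
qed

lemma ray_space_imp_subbase:
  assumes tree: "tree T r" and "X homeomorphic_space ray_space T r"
  shows "\<exists>\<A>. clopen_subbase X \<A> \<and> nested_family \<A> \<and> noetherian_family \<A> \<and>
    hereditarily_complete X \<A> \<and> (special_tree T r \<longrightarrow> sigma_disjoint \<A>)"
proof -
  obtain h where h: "homeomorphic_map X (ray_space T r) h"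
    using assms(2) homeomorphic_space by blast
  then have "h ` topspace X \<subseteq> rays T r"
    using homeomorphic_imp_surjective_map by fastforce
  then show ?thesis
    by (intro exI[of _ "cones T r X h"] conjI impI clopen_subbase_cones[OF h] nested_cones[OF tree]
        noetherian_cones[OF tree] hereditarily_complete_cones[OF tree h] sigma_disjoint_cones)
qed

section \<open>The tree of a subbase\<close>

text \<open>For a nested family and \<open>A\<close> in it, this says that \<open>A\<close> is the
  least member containing some point.\<close>

definition uncovered :: "'a set set \<Rightarrow> 'a set \<Rightarrow> bool" where
  "uncovered \<B> A \<longleftrightarrow> \<not> A \<subseteq> \<Union>{B \<in> \<B>. B \<subset> A}"

text \<open>A covered member keeps the single node \<open>(A, 0)\<close>, so a path ending there has
  a maximal element and is no ray.\<close>

definition spine_nodes :: "'a set set \<Rightarrow> ('a set \<times> nat) set" where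
  "spine_nodes \<B> = {(A, n). A \<in> \<B> \<and> (n = 0 \<or> uncovered \<B> A)}"

definition spine_order :: "'a set set \<Rightarrow> ('a set \<times> nat) rel" where
  "spine_order \<B> = {((A, m), (B, n)). (A, m) \<in> spine_nodes \<B> \<and> (B, n) \<in> spine_nodes \<B> \<and>
     (B \<subset> A \<or> A = B \<and> m \<le> n)}"

text \<open>Larger sets come first, so an infinite descent would be a strictly increasing sequence
  of members.\<close>

lemma noetherian_wf:
  assumes "noetherian_family \<B>"
  shows "wf {(A, B). A \<in> \<B> \<and> B \<in> \<B> \<and> B \<subset> A}"
  unfolding wf_iff_no_infinite_down_chain
proof
  assume "\<exists>f. \<forall>i. (f (Suc i), f i) \<in> {(A, B). A \<in> \<B> \<and> B \<in> \<B> \<and> B \<subset> A}"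
  then obtain f where "\<And>i. (f (Suc i), f i) \<in> {(A, B). A \<in> \<B> \<and> B \<in> \<B> \<and> B \<subset> A}"
    by blast
  then have f: "\<forall>i. f i \<in> \<B>" "\<forall>i. f i \<subset> f (Suc i)"
    by auto
  then have "range f \<subseteq> \<B> \<and> incseq f"
    by (simp add: image_subset_iff incseq_Suc_iff psubset_eq)
  then obtain N where "\<forall>n\<ge>N. f n = f N"
    using assms[unfolded noetherian_family_def, rule_format, of f] by metis
  then have "f (Suc N) = f N"
    by (meson le_SucI order_refl)
  then show False
    using spec[OF f(2), of N] by simp
qed

text \<open>Members containing a common nonempty \<open>C\<close> are nested, which makes
  predecessors comparable, and the lexicographic product with the natural numbers is well-founded.
  An empty member would have all members as predecessors, comparable or not; hence the last
  assumption.\<close>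

lemma tree_spine:
  assumes nested: "nested_family \<B>" and noeth: "noetherian_family \<B>"
    and top: "M \<in> \<B>" "\<And>A. A \<in> \<B> \<Longrightarrow> A \<subseteq> M" and empty: "{} \<in> \<B> \<Longrightarrow> M = {}"
  shows "tree (spine_nodes \<B>) (spine_order \<B>)"
  unfolding tree_def
proof (intro conjI ballI)
  let ?T = "spine_nodes \<B>" and ?r = "spine_order \<B>"
  have refl: "refl_on ?T ?r"
    by (auto simp: refl_on_def spine_order_def)
  have tr: "trans ?r"
    by (rule transI) (auto simp: spine_order_def)
  have anti: "antisym ?r"
    by (rule antisymI) (auto simp: spine_order_def)
  have sub: "?r \<subseteq> ?T \<times> ?T"
    by (auto simp: spine_order_def)
  show "partial_order_on ?T ?r"
    using refl tr anti sub by (simp add: order_on_defs)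
  have node: "(M, 0) \<in> ?T"
    using top(1) by (simp add: spine_nodes_def)
  have least: "((M, 0), t) \<in> ?r" if "t \<in> ?T" for t
    using that top node by (cases t) (auto simp: spine_order_def spine_nodes_def)
  show "\<exists>!m. m \<in> ?T \<and> (\<forall>s\<in>?T. (s, m) \<in> ?r \<longrightarrow> s = m)"
  proof (rule ex1I[of _ "(M, 0)"])
    show "(M, 0) \<in> ?T \<and> (\<forall>s\<in>?T. (s, (M, 0)) \<in> ?r \<longrightarrow> s = (M, 0))"
      using node least anti by (blast dest: antisymD)
    show "m = (M, 0)" if "m \<in> ?T \<and> (\<forall>s\<in>?T. (s, m) \<in> ?r \<longrightarrow> s = m)" for m
      using that node least[of m] by blast
  qed
  fix t assume "t \<in> ?T"
  let ?U = "underS ?r t"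
  have "total_on ?U (Restr ?r ?U)"
  proof (rule total_onI)
    fix p q assume pq: "p \<in> ?U" "q \<in> ?U" "p \<noteq> q"
    obtain A m B n C k where eqs: "p = (A, m)" "q = (B, n)" "t = (C, k)"
      by (metis surj_pair)
    have *: "(A, m) \<in> ?T" "(B, n) \<in> ?T" "A \<in> \<B>" "B \<in> \<B>" "C \<in> \<B>" "C \<subseteq> A" "C \<subseteq> B"
      using pq unfolding eqs underS_def spine_order_def spine_nodes_def by auto
    have "A \<subseteq> B \<or> B \<subseteq> A"
    \<comment> \<open>If \<open>C\<close> is empty then so is \<open>M\<close>, and all members
      coincide.\<close>
    proof (cases "C = {}")
      case True
      then show ?thesis
        using * top(2) empty by blast
    next
      case False
      then have "A \<inter> B \<noteq> {}"
        using * by blast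
      then show ?thesis
        using nested * unfolding nested_family_def by blast
    qed
    then have "(p, q) \<in> ?r \<or> (q, p) \<in> ?r"
      using *(1,2) unfolding eqs spine_order_def by auto
    then show "(p, q) \<in> Restr ?r ?U \<or> (q, p) \<in> Restr ?r ?U"
      using pq by blast
  qed
  moreover have "refl_on ?U (Restr ?r ?U)"
    using refl sub unfolding refl_on_def underS_def by blast
  moreover have "trans (Restr ?r ?U)"
    using tr by (blast intro: transI dest: transD)
  moreover have "antisym (Restr ?r ?U)"
    using anti by (blast intro: antisymI dest: antisymD)
  moreover have "wf (Restr ?r ?U - Id)"
  proof (rule wf_subset)
    show "wf ({(A, B). A \<in> \<B> \<and> B \<in> \<B> \<and> B \<subset> A} <*lex*> less_than)"
      using noetherian_wf[OF noeth] by blast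
    show "Restr ?r ?U - Id \<subseteq> {(A, B). A \<in> \<B> \<and> B \<in> \<B> \<and> B \<subset> A} <*lex*> less_than"
      by (auto simp: spine_order_def spine_nodes_def)
  qed
  ultimately show "well_order_on ?U (Restr ?r ?U)"
    by (simp add: order_on_defs)
qed

text \<open>Each disjoint class gives one antichain for every level \<open>n\<close>: comparable
  nodes on the same level have nested first components, and nested disjoint sets include an empty
  one.\<close>

lemma special_tree_spine:
  assumes tree: "tree (spine_nodes \<B>) (spine_order \<B>)"
    and \<B>: "\<B> \<subseteq> insert M \<A>" "{} \<notin> \<B> - {M}" and \<A>: "sigma_disjoint \<A>"
  shows "special_tree (spine_nodes \<B>) (spine_order \<B>)"
proof -
  obtain \<DD> where \<DD>: "countable \<DD>" "\<A> = \<Union>\<DD>" "\<And>\<D>. \<D> \<in> \<DD> \<Longrightarrow> pairwise disjnt \<D>"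
    using \<A> by (auto simp: sigma_disjoint_def)
  define L where "L = (\<lambda>(\<D>, n). {(A, n) | A. A \<in> \<D> \<and> (A, n) \<in> spine_nodes \<B>})"
  \<comment> \<open>The root \<open>M\<close> gets its own class because it may be missing from
    \<open>\<A>\<close>. It is removed from the other classes because it may be empty, and an empty
    set is disjoint from sets that contain it.\<close>
  define \<EE> where "\<EE> = insert {M} ((\<lambda>\<D>. \<D> - {M}) ` \<DD>)"
  have "countable (L ` (\<EE> \<times> UNIV))"
    using \<DD>(1) unfolding \<EE>_def by (intro countable_image countable_SIGMA) auto
  moreover have "tree_antichain (spine_nodes \<B>) (spine_order \<B>) (L (\<D>, n))" if "\<D> \<in> \<EE>" for \<D> n
  proof -
    have "A = B" if AB: "A \<in> \<D>" "B \<in> \<D>" "A \<in> \<B>" "B \<in> \<B>" "B \<subseteq> A" for A B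
    proof (rule ccontr)
      assume "A \<noteq> B"
      then obtain \<D>' where "\<D>' \<in> \<DD>" "\<D> = \<D>' - {M}"
        using \<open>\<D> \<in> \<EE>\<close> AB unfolding \<EE>_def by auto
      then have "disjnt A B" "B \<noteq> M"
        using \<DD>(3) AB \<open>A \<noteq> B\<close> by (auto simp: pairwise_def)
      moreover from this have "B = {}"
        using AB(5) by (auto simp: disjnt_def)
      ultimately show False
        using AB(4) \<B>(2) by blast
    qed
    then show ?thesis
      unfolding tree_antichain_def L_def spine_order_def spine_nodes_def by auto
  qed
  moreover have "spine_nodes \<B> = \<Union>(L ` (\<EE> \<times> UNIV))"
  proof
    show "\<Union>(L ` (\<EE> \<times> UNIV)) \<subseteq> spine_nodes \<B>"
      by (auto simp: L_def)
    show "spine_nodes \<B> \<subseteq> \<Union>(L ` (\<EE> \<times> UNIV))"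
    proof
      fix p assume p: "p \<in> spine_nodes \<B>"
      obtain A n where A: "p = (A, n)"
        by force
      then have "A \<in> insert M \<A>"
        using p \<B>(1) by (auto simp: spine_nodes_def)
      then obtain \<D> where "\<D> \<in> \<EE>" "A \<in> \<D>"
        using \<DD>(2) by (cases "A = M") (auto simp: \<EE>_def)
      then show "p \<in> \<Union>(L ` (\<EE> \<times> UNIV))"
        using p A by (intro UnionI[of "L (\<D>, n)"]) (auto simp: L_def)
    qed
  qed
  ultimately show ?thesis
    unfolding special_tree_def using tree by blast
qed

section \<open>Points of the space as rays of the tree of its subbase\<close>

locale ray_subbase =
  fixes X :: "'a topology" and \<A> :: "'a set set"
  assumes hausdorff: "Hausdorff_space X"
    and subbase: "clopen_subbase X \<A>"
    and nested: "nested_family \<A>"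
    and noetherian: "noetherian_family \<A>"
    and complete: "hereditarily_complete X \<A>"
begin

text \<open>The whole space provides the root. The empty set is dropped because its predecessors
  need not form a chain; it survives only as the root when \<open>X\<close> is empty.\<close>

definition \<B> :: "'a set set" where
  "\<B> = insert (topspace X) (\<A> - {{}})"

definition point_ray :: "'a \<Rightarrow> ('a set \<times> nat) set" where
  "point_ray x = {p \<in> spine_nodes \<B>. x \<in> fst p}"

lemma top_in_\<B>: "topspace X \<in> \<B>"
  by (simp add: \<B>_def)

lemma clopen_\<B>: "A \<in> \<B> \<Longrightarrow> openin X A \<and> closedin X A"
  using clopen_subbase_clopen[OF subbase] by (auto simp: \<B>_def)

lemma subset_\<B>: "A \<in> \<B> \<Longrightarrow> A \<subseteq> topspace X"
  using clopen_\<B> openin_subset by blast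

lemma nested_\<B>: "nested_family \<B>"
  unfolding nested_family_def
proof (intro ballI impI)
  fix A B assume "A \<in> \<B>" "B \<in> \<B>" "A \<inter> B \<noteq> {}"
  then show "A \<subseteq> B \<or> B \<subseteq> A"
    using nested subset_\<B> unfolding nested_family_def \<B>_def by blast
qed

lemma nestedD_\<B>: "A \<in> \<B> \<Longrightarrow> B \<in> \<B> \<Longrightarrow> x \<in> A \<Longrightarrow> x \<in> B \<Longrightarrow> A \<subseteq> B \<or> B \<subseteq> A"
  using nested_\<B> unfolding nested_family_def by blast

lemma noetherian_\<B>: "noetherian_family \<B>"
  unfolding noetherian_family_def
proof (intro allI impI; elim conjE)
  fix f :: "nat \<Rightarrow> 'a set" assume f: "range f \<subseteq> \<B>" "incseq f"
  show "\<exists>N. \<forall>n\<ge>N. f n = f N"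
  proof (cases "\<exists>N. f N = topspace X")
    case True
    then obtain N where N: "f N = topspace X"
      by blast
    have "f n = f N" if "n \<ge> N" for n
    proof
      show "f n \<subseteq> f N"
        using f(1) subset_\<B> N by blast
      show "f N \<subseteq> f n"
        using f(2) that by (auto simp: incseq_def)
    qed
    then show ?thesis
      by blast
  next
    case False
    then have "range f \<subseteq> \<A> \<and> incseq f"
      using f unfolding \<B>_def by blast
    then show ?thesis
      by (rule noetherian[unfolded noetherian_family_def, rule_format])
  qed
qed

lemma tree_\<B>: "tree (spine_nodes \<B>) (spine_order \<B>)"
  using nested_\<B> noetherian_\<B> top_in_\<B> subset_\<B>
  by (rule tree_spine) (auto simp: \<B>_def)

text \<open>If \<open>P\<close> has a least member \<open>A\<close>, a point of \<open>A\<close>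
  outside all smaller members works. Otherwise hereditary completeness is applied to the complement
  of the intersection of \<open>P\<close>.\<close>

lemma path_point:
  assumes P: "P \<subseteq> \<B>" "P \<noteq> {}"
    and chain: "\<And>A B. A \<in> P \<Longrightarrow> B \<in> P \<Longrightarrow> A \<subseteq> B \<or> B \<subseteq> A"
    and up: "\<And>A B. A \<in> P \<Longrightarrow> B \<in> \<B> \<Longrightarrow> A \<subseteq> B \<Longrightarrow> B \<in> P"
    and last: "\<And>A. A \<in> P \<Longrightarrow> \<forall>B\<in>P. A \<subseteq> B \<Longrightarrow> uncovered \<B> A"
  shows "\<exists>x\<in>topspace X. P = {A \<in> \<B>. x \<in> A}"
proof (cases "\<exists>A\<in>P. \<forall>B\<in>P. A \<subseteq> B")
  case True
  then obtain A where A: "A \<in> P" "\<forall>B\<in>P. A \<subseteq> B"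
    by blast
  have "uncovered \<B> A"
    using last[OF A] .
  then obtain x where x: "x \<in> A" "\<And>B. B \<in> \<B> \<Longrightarrow> B \<subset> A \<Longrightarrow> x \<notin> B"
    unfolding uncovered_def by blast
  have "B \<in> P" if "B \<in> \<B>" "x \<in> B" for B
  proof -
    have "A \<subseteq> B \<or> B \<subseteq> A"
      using nestedD_\<B>[of A B x] A(1) P(1) that x(1) by blast
    then show ?thesis
      using x(2) that up[OF A(1) that(1)] by blast
  qed
  then have "P = {B \<in> \<B>. x \<in> B}"
    using A(2) P(1) x(1) by blast
  moreover have "x \<in> topspace X"
    using x(1) A(1) P(1) subset_\<B> by blast
  ultimately show ?thesis
    by (rule bexI)
next
  case False
  have smaller: "\<exists>B\<in>P. B \<subset> A" if "A \<in> P" for A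
  proof -
    from False that obtain B where "B \<in> P" "\<not> A \<subseteq> B"
      by blast
    then show ?thesis
      using chain[of A B] that by blast
  qed
  show ?thesis
  proof (rule ccontr)
    assume contra: "\<not> ?thesis"
    have PX: "\<Inter>P \<subseteq> topspace X"
      using P subset_\<B> by blast
    \<comment> \<open>As \<open>x\<close> does not realize \<open>P\<close>, some member
      \<open>B\<close> contains \<open>x\<close> without being in \<open>P\<close>. Being comparable
      with each member of \<open>P\<close> and containing none of them, \<open>B\<close> lies in all
      of them. This makes the intersection open even when \<open>P\<close> is infinite.\<close>
    have "\<exists>B\<in>\<B>. x \<in> B \<and> B \<subseteq> \<Inter>P" if x: "x \<in> \<Inter>P" for x
    proof -
      have "P \<noteq> {A \<in> \<B>. x \<in> A}"
        using contra PX x by blast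
      then obtain B where B: "B \<in> \<B>" "x \<in> B" "B \<notin> P"
        using P(1) x by blast
      have "B \<subseteq> A" if "A \<in> P" for A
      proof -
        have "A \<subseteq> B \<or> B \<subseteq> A"
          using nestedD_\<B>[of A B x] that P(1) B(1,2) x by blast
        then show ?thesis
          using up[OF that B(1)] B(3) by blast
      qed
      then show ?thesis
        using B by blast
    qed
    then have "openin X (\<Inter>P)"
      using clopen_\<B> by (subst openin_subopen) meson
    then have Y: "closedin X (topspace X - \<Inter>P)"
      by blast
    let ?Y = "topspace X - \<Inter>P"
    \<comment> \<open>The whole space is left out since it may not belong to \<open>\<A>\<close>; it
      contains \<open>?Y\<close> anyway.\<close>
    let ?\<P> = "(\<lambda>A. A \<inter> ?Y) ` (P - {topspace X})"
    have "?\<P> \<subseteq> (\<lambda>A. A \<inter> ?Y) ` \<A>"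
      using P(1) unfolding \<B>_def by blast
    moreover have nonempty: "P - {topspace X} \<noteq> {}"
    proof -
      obtain A where "A \<in> P"
        using P(2) by blast
      then obtain B where "B \<in> P" "B \<subset> A"
        using smaller by blast
      moreover from this have "B \<noteq> topspace X"
        using P(1) subset_\<B>[of A] \<open>A \<in> P\<close> by auto
      ultimately show ?thesis
        by blast
    qed
    moreover have "centered_family ?\<P>"
      unfolding centered_family_def
    proof (intro allI impI; elim conjE)
      fix \<F> assume "\<F> \<subseteq> ?\<P>" "finite \<F>" "\<F> \<noteq> {}"
      then obtain F where F: "F \<subseteq> P - {topspace X}" "finite F" "\<F> = (\<lambda>A. A \<inter> ?Y) ` F"
        by (meson finite_subset_image)
      then have "F \<noteq> {}"
        using \<open>\<F> \<noteq> {}\<close> by blast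
      have "\<exists>A\<in>P. \<forall>B\<in>F. A \<subseteq> B"
        using \<open>finite F\<close> \<open>F \<noteq> {}\<close> F(1)
      proof (induction F rule: finite_ne_induct)
        case (insert B F)
        then obtain A where "A \<in> P" "\<forall>B\<in>F. A \<subseteq> B"
          by blast
        moreover have "B \<in> P"
          using insert.prems by blast
        ultimately consider "A \<subseteq> B" | "B \<subseteq> A"
          using chain by blast
        then show ?case
          using \<open>A \<in> P\<close> \<open>\<forall>B\<in>F. A \<subseteq> B\<close> \<open>B \<in> P\<close> by cases blast+
      qed blast
      then obtain A where A: "A \<in> P" "\<forall>B\<in>F. A \<subseteq> B"
        by blast
      \<comment> \<open>A point of \<open>A\<close> outside the smaller \<open>B\<close> is outside
        the intersection of \<open>P\<close>, so it lies in \<open>?Y\<close> and in every set of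
        the finite subfamily.\<close>
      obtain B where "B \<in> P" "B \<subset> A"
        using smaller A(1) by blast
      then obtain a where "a \<in> A" "a \<notin> B"
        by blast
      moreover from this have "a \<in> ?Y"
        using A(1) P(1) subset_\<B>[of A] \<open>B \<in> P\<close> by blast
      ultimately have "a \<in> \<Inter>\<F>"
        unfolding F(3) using A(2) by blast
      then show "\<Inter>\<F> \<noteq> {}"
        by blast
    qed
    moreover have "complete_family ((\<lambda>A. A \<inter> ?Y) ` \<A>)"
      using complete Y by (simp add: hereditarily_complete_def)
    ultimately have "\<Inter>?\<P> \<noteq> {}"
      unfolding complete_family_def by (metis (no_types, lifting) image_is_empty)
    then obtain y where y: "y \<in> \<Inter>?\<P>"
      by blast
    then have "y \<in> ?Y"
      using nonempty by blast
    moreover have "y \<in> A" if "A \<in> P" for A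
      using y that \<open>y \<in> ?Y\<close> by (cases "A = topspace X") blast+
    ultimately show False
      by blast
  qed
qed

text \<open>Above a node \<open>(A, n)\<close> there is always another one: either \<open>x\<close>
  lies in a smaller member, or \<open>x\<close> itself shows that \<open>A\<close> is uncovered and
  \<open>(A, Suc n)\<close> is a node.\<close>

lemma point_ray_in_rays:
  assumes x: "x \<in> topspace X"
  shows "point_ray x \<in> rays (spine_nodes \<B>) (spine_order \<B>)"
proof -
  let ?T = "spine_nodes \<B>" and ?r = "spine_order \<B>"
  have "(topspace X, 0) \<in> point_ray x"
    using x top_in_\<B> by (simp add: point_ray_def spine_nodes_def)
  moreover have "point_ray x \<in> Chains ?r"
    unfolding Chains_def
  proof (intro CollectI ballI)
    fix p q assume pq: "p \<in> point_ray x" "q \<in> point_ray x"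
    obtain A m B n where eqs: "p = (A, m)" "q = (B, n)"
      by (metis surj_pair)
    have *: "(A, m) \<in> ?T" "(B, n) \<in> ?T" "A \<in> \<B>" "B \<in> \<B>" "x \<in> A" "x \<in> B"
      using pq unfolding eqs point_ray_def spine_nodes_def by auto
    then have "A \<subseteq> B \<or> B \<subseteq> A"
      using nestedD_\<B>[of A B x] by blast
    then show "(p, q) \<in> ?r \<or> (q, p) \<in> ?r"
      using *(1,2) unfolding eqs spine_order_def by auto
  qed
  moreover have "\<forall>t\<in>point_ray x. \<forall>s\<in>?T. (s, t) \<in> ?r \<longrightarrow> s \<in> point_ray x"
    unfolding point_ray_def spine_order_def by auto
  moreover have "\<exists>s\<in>point_ray x. (t, s) \<in> ?r \<and> s \<noteq> t" if "t \<in> point_ray x" for t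
  proof -
    obtain A n where t: "t = (A, n)"
      by force
    have A: "(A, n) \<in> ?T" "A \<in> \<B>" "x \<in> A"
      using that unfolding t point_ray_def spine_nodes_def by auto
    show ?thesis
    proof (cases "\<exists>B\<in>\<B>. B \<subset> A \<and> x \<in> B")
      case True
      then obtain B where "B \<in> \<B>" "B \<subset> A" "x \<in> B"
        by blast
      then show ?thesis
        using A unfolding t point_ray_def spine_order_def spine_nodes_def
        by (intro bexI[of _ "(B, 0)"]) auto
    next
      case False
      then have "uncovered \<B> A"
        using A(3) unfolding uncovered_def by blast
      then show ?thesis
        using A unfolding t point_ray_def spine_order_def spine_nodes_def
        by (intro bexI[of _ "(A, Suc n)"]) auto
    qed
  qed
  moreover have "point_ray x \<subseteq> ?T"
    by (auto simp: point_ray_def)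
  ultimately show ?thesis
    unfolding rays_def tree_path_def by blast
qed

text \<open>A ray contains all copies of a member or none of them, so it is determined by the set
  \<open>P\<close> of its members, to which \<open>path_point\<close> applies.\<close>

lemma ray_is_point_ray:
  assumes R: "R \<in> rays (spine_nodes \<B>) (spine_order \<B>)"
  obtains x where "x \<in> topspace X" and "point_ray x = R"
proof -
  let ?T = "spine_nodes \<B>" and ?r = "spine_order \<B>"
  note comp = rays_comparable[OF R] and down = rays_downward[OF tree_\<B> R]
  have RT: "R \<subseteq> ?T" and ne: "R \<noteq> {}"
    using rays_tree_path[OF R] by (auto simp: tree_path_def)
  have no_max: "\<exists>s\<in>R. (m, s) \<in> ?r \<and> s \<noteq> m" if "m \<in> R" for m
    using conjunct2[OF R[unfolded rays_def mem_Collect_eq]] that by blast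
  have zero: "(A, 0) \<in> R" if "(A, m) \<in> R" for A m
  proof -
    have "(A, m) \<in> ?T"
      using that RT by blast
    then have "((A, 0), (A, m)) \<in> ?r"
      by (simp add: spine_order_def spine_nodes_def)
    then show ?thesis
      using down[OF that] by blast
  qed
  have spine: "(A, n) \<in> R" if "(A, 0) \<in> R" "(A, n) \<in> ?T" for A n
    using that(2)
  proof (induction n)
    case 0
    then show ?case
      using that(1) by simp
  next
    case (Suc n)
    have "uncovered \<B> A" "A \<in> \<B>"
      using Suc.prems by (auto simp: spine_nodes_def)
    then have "(A, n) \<in> R"
      using Suc.IH by (simp add: spine_nodes_def)
    then obtain s where s: "s \<in> R" "((A, n), s) \<in> ?r" "s \<noteq> (A, n)"
      using no_max by blast
    \<comment> \<open>A node strictly above \<open>(A, n)\<close> is a later copy of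
      \<open>A\<close> or belongs to a smaller member; in both cases it is at or above the next
      copy.\<close>
    then have "((A, Suc n), s) \<in> ?r"
      using Suc.prems by (cases s) (auto simp: spine_order_def)
    then show ?case
      using down[OF s(1)] by blast
  qed
  define P where "P = {A. (A, 0) \<in> R}"
  have R_eq: "R = {p \<in> ?T. fst p \<in> P}"
  proof (intro set_eqI)
    fix p :: "'a set \<times> nat"
    show "p \<in> R \<longleftrightarrow> p \<in> {p \<in> ?T. fst p \<in> P}"
      using RT zero spine[of "fst p" "snd p"] unfolding P_def by (cases p) fastforce
  qed
  have "P \<subseteq> \<B>"
    using RT by (auto simp: P_def spine_nodes_def)
  moreover have "P \<noteq> {}"
    using ne zero unfolding P_def by fastforce
  moreover have "A \<subseteq> B \<or> B \<subseteq> A" if "A \<in> P" "B \<in> P" for A B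
    using comp[of "(A, 0)" "(B, 0)"] that by (auto simp: P_def spine_order_def)
  moreover have "B \<in> P" if "A \<in> P" "B \<in> \<B>" "A \<subseteq> B" for A B
  proof -
    have "(A, 0) \<in> R"
      using that(1) by (simp add: P_def)
    moreover have "((B, 0), (A, 0)) \<in> ?r"
      using that(2,3) subsetD[OF RT \<open>(A, 0) \<in> R\<close>] by (auto simp: spine_order_def spine_nodes_def)
    ultimately show ?thesis
      using down by (simp add: P_def)
  qed
  \<comment> \<open>For a least \<open>A\<close> in \<open>P\<close>, a node of the ray above
    \<open>(A, 0)\<close> must be a further copy of \<open>A\<close>, and only uncovered members
    have one.\<close>
  moreover have "uncovered \<B> A" if A: "A \<in> P" "\<forall>B\<in>P. A \<subseteq> B" for A
  proof -
    have "(A, 0) \<in> R"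
      using A(1) by (simp add: P_def)
    then obtain B n where s: "(B, n) \<in> R" "((A, 0), (B, n)) \<in> ?r" "(B, n) \<noteq> (A, 0)"
      using no_max by (metis surj_pair)
    moreover have "A \<subseteq> B"
      using A(2) zero[OF s(1)] by (simp add: P_def)
    ultimately show ?thesis
      by (auto simp: spine_order_def spine_nodes_def)
  qed
  ultimately have "\<exists>x\<in>topspace X. P = {A \<in> \<B>. x \<in> A}"
    by (rule path_point)
  then obtain x where x: "x \<in> topspace X" "P = {A \<in> \<B>. x \<in> A}"
    by (rule bexE)
  have "point_ray x = R"
    unfolding R_eq x(2) point_ray_def by (auto simp: spine_nodes_def)
  then show thesis
    using that x(1) by blast
qed

text \<open>The Hausdorff property enters here: distinct points are separated by an open set, hence
  by a member \<open>A\<close> of the subbase, hence by the node \<open>(A, 0)\<close>.\<close>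

lemma inj_on_point_ray: "inj_on point_ray (topspace X)"
proof (rule inj_onI, rule ccontr)
  fix x y assume xy: "x \<in> topspace X" "y \<in> topspace X" "point_ray x = point_ray y" "x \<noteq> y"
  then obtain U where "openin X U" "x \<in> U" "y \<notin> U"
    using hausdorff unfolding Hausdorff_space_def disjnt_def by (metis disjoint_iff)
  then obtain A where A: "A \<in> \<A>" "(x \<in> A) \<noteq> (y \<in> A)"
    using clopen_subbase_separates[OF subbase _ _ xy(2)] by metis
  then have "A \<noteq> {}"
    by blast
  then have "(A, 0) \<in> spine_nodes \<B>"
    using A(1) by (simp add: \<B>_def spine_nodes_def)
  then have "(A, 0) \<in> point_ray z \<longleftrightarrow> z \<in> A" for z
    by (simp add: point_ray_def)
  then show False
    using A(2) xy(3) by blast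
qed

text \<open>The two subbases correspond: the cone of \<open>(A, n)\<close> pulls back to
  \<open>A\<close> for every \<open>n\<close>, and a nonempty \<open>A\<close> corresponds to the
  cone of \<open>(A, 0)\<close>.\<close>

lemma homeomorphic_spine: "X homeomorphic_space ray_space (spine_nodes \<B>) (spine_order \<B>)"
proof -
  let ?T = "spine_nodes \<B>" and ?r = "spine_order \<B>"
  let ?Z = "ray_space ?T ?r"
  let ?g = "inv_into (topspace X) point_ray"
  have bij: "bij_betw point_ray (topspace X) (rays ?T ?r)"
    unfolding bij_betw_def
    using inj_on_point_ray point_ray_in_rays ray_is_point_ray
    by (metis (lifting) image_eqI image_subsetI subsetI subset_antisym)
  have g: "?g R \<in> topspace X" "point_ray (?g R) = R" if "R \<in> rays ?T ?r" for R
    using bij that by (auto simp: bij_betw_def inv_into_into f_inv_into_f)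
  have gf: "?g (point_ray x) = x" if "x \<in> topspace X" for x
    using inj_on_point_ray that by (rule inv_into_f_f)
  have "continuous_map X ?Z point_ray"
    using ray_space_clopen_subbase
  proof (rule continuous_map_clopen_subbase)
    show "point_ray \<in> topspace X \<rightarrow> topspace ?Z"
      using point_ray_in_rays by auto
    fix B assume "B \<in> (\<lambda>t. {x \<in> rays ?T ?r. t \<in> x}) ` ?T"
    then obtain A n where A: "(A, n) \<in> ?T" "B = {x \<in> rays ?T ?r. (A, n) \<in> x}"
      by auto
    then have "A \<in> \<B>"
      by (simp add: spine_nodes_def)
    moreover have "{x \<in> topspace X. point_ray x \<in> B} = A"
      using A subset_\<B>[OF \<open>A \<in> \<B>\<close>] point_ray_in_rays by (auto simp: point_ray_def)
    ultimately show "openin X {x \<in> topspace X. point_ray x \<in> B} \<and>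
        closedin X {x \<in> topspace X. point_ray x \<in> B}"
      using clopen_\<B> by simp
  qed
  moreover have "continuous_map ?Z X ?g"
    using subbase
  proof (rule continuous_map_clopen_subbase)
    show "?g \<in> topspace ?Z \<rightarrow> topspace X"
      using g(1) by auto
    fix A assume A: "A \<in> \<A>"
    show "openin ?Z {R \<in> topspace ?Z. ?g R \<in> A} \<and> closedin ?Z {R \<in> topspace ?Z. ?g R \<in> A}"
    proof (cases "A = {}")
      case False
      then have node: "(A, 0) \<in> ?T"
        using A by (simp add: \<B>_def spine_nodes_def)
      have "(A, 0) \<in> point_ray x \<longleftrightarrow> x \<in> A" for x
        using node by (simp add: point_ray_def)
      then have "?g R \<in> A \<longleftrightarrow> (A, 0) \<in> R" if "R \<in> rays ?T ?r" for R
        using g(2)[OF that] by metis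
      then have "{R \<in> topspace ?Z. ?g R \<in> A} = {R \<in> rays ?T ?r. (A, 0) \<in> R}"
        by auto
      then show ?thesis
        using clopen_subbase_clopen[OF ray_space_clopen_subbase imageI[OF node]] by simp
    qed simp
  qed
  ultimately have "homeomorphic_maps X ?Z point_ray ?g"
    unfolding homeomorphic_maps_def using g(2) gf by simp
  then show ?thesis
    unfolding homeomorphic_space_def by blast
qed

end

section \<open>The equivalence of trees and subbases\<close>

lemma subbase_imp_ray_space:
  fixes X :: "'a topology"
  assumes "Hausdorff_space X" and "clopen_subbase X \<A>" and "nested_family \<A>"
    and "noetherian_family \<A>" and "hereditarily_complete X \<A>"
  shows "\<exists>(T :: ('a set \<times> nat) set) r. tree T r \<and> X homeomorphic_space ray_space T r \<and>
    (sigma_disjoint \<A> \<longrightarrow> special_tree T r)"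
proof -
  interpret ray_subbase X \<A>
    using assms by unfold_locales
  have "special_tree (spine_nodes \<B>) (spine_order \<B>)" if "sigma_disjoint \<A>"
    using tree_\<B> _ _ that by (rule special_tree_spine[where M = "topspace X"]) (auto simp: \<B>_def)
  then show ?thesis
    using tree_\<B> homeomorphic_spine by blast
qed

(* HOL cannot quantify existentially over types, so "some tree T" is rendered by an equivalence
   with the nodes taken from the type 'a set * nat, together with the forward implication for
   trees over an arbitrary type 'b. *)
theorem theorem1p2:
  fixes X :: "'a topology"
  assumes "Hausdorff_space X"
  shows
    "(((\<exists>(T :: ('a set \<times> nat) set) r. tree T r \<and> X homeomorphic_space ray_space T r) \<longleftrightarrow>
        (\<exists>\<A>. clopen_subbase X \<A> \<and> nested_family \<A> \<and> noetherian_family \<A> \<and>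
             hereditarily_complete X \<A>)) \<and>
      (\<forall>(T :: 'b set) r. tree T r \<and> X homeomorphic_space ray_space T r \<longrightarrow>
        (\<exists>\<A>. clopen_subbase X \<A> \<and> nested_family \<A> \<and> noetherian_family \<A> \<and>
             hereditarily_complete X \<A>)))
     \<and>
     (((\<exists>(T :: ('a set \<times> nat) set) r. special_tree T r \<and> X homeomorphic_space ray_space T r) \<longleftrightarrow>
        (\<exists>\<A>. clopen_subbase X \<A> \<and> nested_family \<A> \<and> noetherian_family \<A> \<and>
             hereditarily_complete X \<A> \<and> sigma_disjoint \<A>)) \<and>
      (\<forall>(T :: 'b set) r. special_tree T r \<and> X homeomorphic_space ray_space T r \<longrightarrow>
        (\<exists>\<A>. clopen_subbase X \<A> \<and> nested_family \<A> \<and> noetherian_family \<A> \<and>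
             hereditarily_complete X \<A> \<and> sigma_disjoint \<A>)))"
  (is "((?t \<longleftrightarrow> ?\<A>) \<and> ?t') \<and> ((?s \<longleftrightarrow> ?\<D>) \<and> ?s')")
proof -
  have ?t if ?\<A>
    using that subbase_imp_ray_space[OF assms] by (elim exE conjE) metis
  moreover have ?\<A> if ?t
    using that by (elim exE conjE) (drule (1) ray_space_imp_subbase, blast)
  moreover have ?t'
    by (intro allI impI, elim exE conjE) (drule (1) ray_space_imp_subbase, blast)
  moreover have ?s if ?\<D>
    using that subbase_imp_ray_space[OF assms] by (elim exE conjE) metis
  moreover have ?\<D> if ?s
    using that
    by (elim exE conjE) (frule special_tree_imp_tree, drule (1) ray_space_imp_subbase, blast)
  moreover have ?s'
    by (intro allI impI, elim exE conjE)
      (frule special_tree_imp_tree, drule (1) ray_space_imp_subbase, blast)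
  ultimately show ?thesis
    by (intro conjI iffI)
qed

end
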